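(* Let $V=\{v_1,\dots,v_m\}\subset\mathbb{R}^d$ be a finite set of points and let $r$ be a point in the interior of $\operatorname{conv}(V)$. Then the geometric realization $|\mathcal{K}(V,r)|$ of the simplicial complex of non-balanced subsets of $V$ is homotopy equivalent to the sphere $S^{d-1}$.
   Context: A subset $S\subset V$ is called $r$-balanced if $r\in\operatorname{conv}(S)$. The simplicial complex of non-balanced subsets is the abstract simplicial complex on the vertices $v_1,\dots,v_m$ given by $\mathcal{K}(V,r)=\{S\subset V \mid r\notin\operatorname{conv}(S)\}$. *)

theory Defs
  imports "HOL-Analysis.Analysis"
begin

definition balanced :: "'a::real_vector \<Rightarrow> 'a set \<Rightarrow> bool" where
  "balanced r S \<longleftrightarrow> r \<in> convex hull S"

text \<open>An abstract simplicial complex is represented by its set of faces, the empty face included.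
  A point of \<open>V\<close> equal to \<open>r\<close> is a ghost vertex of \<open>nonbalanced_complex V r\<close>.\<close>

definition simplicial_complex :: "'a set set \<Rightarrow> bool" where
  "simplicial_complex K \<longleftrightarrow>
     {} \<in> K \<and> (\<forall>S\<in>K. finite S) \<and> (\<forall>S\<in>K. \<forall>T. T \<subseteq> S \<longrightarrow> T \<in> K)"

definition nonbalanced_complex :: "'a::real_vector set \<Rightarrow> 'a \<Rightarrow> 'a set set" where
  "nonbalanced_complex V r = {S. S \<subseteq> V \<and> \<not> balanced r S}"

lemma simplicial_complex_nonbalanced_complex:
  assumes "finite V"
  shows "simplicial_complex (nonbalanced_complex V r)"
  unfolding simplicial_complex_def nonbalanced_complex_def balanced_def
  using assms by (auto intro: finite_subset dest: hull_mono)

text \<open>Points of the realization are given by their barycentric coordinates, extended by \<open>0\<close> to the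
  whole type of vertices. The topology is the one induced by the product topology on functions; for
  a complex with finitely many vertices it is the Euclidean topology of the coordinates and agrees
  with the weak topology determined by the closed simplices. For infinite complexes it may be
  coarser than the weak topology.\<close>

definition geometric_realization :: "'a set set \<Rightarrow> ('a \<Rightarrow> real) topology" where
  "geometric_realization K = top_of_set
     {x. {v. x v \<noteq> 0} \<in> K \<and> (\<forall>v. 0 \<le> x v) \<and> (\<Sum>v | x v \<noteq> 0. x v) = 1}"

end

theory Submission
  imports Defs
begin

text \<open>
  Write \<open>K\<close> for the complex of nonbalanced sets. A set \<open>S \<subseteq> V\<close> lies in \<open>K\<close> exactly if its open dual
  cone \<open>C S = {u. \<forall>v\<in>S. u \<bullet> (v - r) > 0}\<close> is nonempty. These cones are convex, they shrink as \<open>S\<close>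
  grows, and \<open>C S\<close> omits the origin unless \<open>S\<close> is empty. The two homotopy inverse maps exploit
  this duality between faces and directions.

  A direction \<open>u\<close> is sent to the point \<open>cap_point V r u\<close> of the realization whose coordinate at \<open>v\<close>
  is proportional to the positive part of \<open>u \<bullet> (v - r)\<close>. Its support, the open cap
  \<open>{v\<in>V. u \<bullet> (v - r) > 0}\<close>, is the largest face whose cone contains \<open>u\<close>; it is nonempty because \<open>r\<close> is
  interior to the convex hull.

  In the other direction one would like to choose continuously for each \<open>x\<close> a vector in \<open>C S\<close>, where
  \<open>S\<close> is the support of \<open>x\<close>. That is too much to ask, since the support jumps up, and its
  cone jumps down, near each point of a proper face. It suffices to control the vertices at which \<open>x\<close>
  is at least some small \<open>\<epsilon> > 0\<close>. Fix a vector \<open>c S \<in> C S\<close> for each face, and average the \<open>c S\<close> with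
  weights that are nonzero only if \<open>{v. x v \<ge> \<epsilon>} \<subseteq> S \<subseteq> {v. x v > 0}\<close>. The average
  \<open>direction V c \<epsilon> x\<close> lies in \<open>C {v. x v \<ge> \<epsilon>}\<close> (\<open>inner_direction_pos\<close>), and if \<open>\<epsilon>\<close> is less
  than the reciprocal of the number of vertices, then \<open>{v. x v \<ge> \<epsilon>}\<close> is nonempty, so that the average
  is not zero.

  Both composites are homotopic to the identity along straight lines. Starting from a direction \<open>u\<close>,
  the vectors \<open>u\<close> and \<open>direction V c \<epsilon> (cap_point V r u)\<close> lie in a common cone that omits the origin,
  so the segment between them projects to the sphere. Starting from a point \<open>x\<close>, the
  segment from \<open>x\<close> to its truncation \<open>truncation V \<epsilon> x\<close>, which is supported on \<open>{v. x v > \<epsilon>}\<close>, stays in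
  the carrier of \<open>x\<close>; and the cap of the chosen direction contains the support of the truncation, so
  a second segment in the simplex of this cap finishes the homotopy.
\<close>

section \<open>Points and straight lines in the realization\<close>

definition realization_points :: "'a set set \<Rightarrow> ('a \<Rightarrow> real) set" where
  "realization_points K =
     {x. {v. x v \<noteq> 0} \<in> K \<and> (\<forall>v. 0 \<le> x v) \<and> (\<Sum>v | x v \<noteq> 0. x v) = 1}"

lemma geometric_realization_eq: "geometric_realization K = top_of_set (realization_points K)"
  by (simp add: geometric_realization_def realization_points_def)

lemma sum_support:
  fixes x :: "'a \<Rightarrow> real"
  assumes "finite T" "{v. x v \<noteq> 0} \<subseteq> T"
  shows "(\<Sum>v | x v \<noteq> 0. x v) = sum x T"
  using assms by (intro sum.mono_neutral_left) auto

lemma realization_points_nonneg: "x \<in> realization_points K \<Longrightarrow> 0 \<le> x v"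
  by (simp add: realization_points_def)

lemma realization_points_support: "x \<in> realization_points K \<Longrightarrow> {v. x v \<noteq> 0} \<in> K"
  by (simp add: realization_points_def)

lemma realization_points_sum:
  assumes "x \<in> realization_points K" "finite T" "{v. x v \<noteq> 0} \<subseteq> T"
  shows "sum x T = 1"
  using assms sum_support[of T x] by (simp add: realization_points_def)

lemma convex_combination_in_realization:
  assumes K: "simplicial_complex K" and T: "T \<in> K"
    and x: "x \<in> realization_points K" "{v. x v \<noteq> 0} \<subseteq> T"
    and y: "y \<in> realization_points K" "{v. y v \<noteq> 0} \<subseteq> T"
    and t: "0 \<le> t" "t \<le> 1"
  shows "(\<lambda>v. (1 - t) * x v + t * y v) \<in> realization_points K"
proof -
  let ?z = "\<lambda>v. (1 - t) * x v + t * y v"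
  have fin: "finite T" using K T by (simp add: simplicial_complex_def)
  have supp: "{v. ?z v \<noteq> 0} \<subseteq> T"
  proof
    fix v assume "v \<in> {v. ?z v \<noteq> 0}"
    then have "x v \<noteq> 0 \<or> y v \<noteq> 0" by auto
    then show "v \<in> T" using x(2) y(2) by blast
  qed
  then have "{v. ?z v \<noteq> 0} \<in> K" using K T by (simp add: simplicial_complex_def)
  moreover have "0 \<le> ?z v" for v
    using t realization_points_nonneg[OF x(1)] realization_points_nonneg[OF y(1)] by simp
  moreover have "sum ?z T = 1"
    using realization_points_sum[OF x(1) fin x(2)] realization_points_sum[OF y(1) fin y(2)]
    by (simp add: sum.distrib flip: sum_distrib_left)
  ultimately show ?thesis
    using sum_support[OF fin supp] by (simp add: realization_points_def)
qed

text \<open>The segment from \<open>f s\<close> to \<open>g s\<close> lies in the simplex spanned by the support of \<open>g s\<close>.\<close>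

lemma homotopic_into_realization:
  fixes f g :: "'b::topological_space \<Rightarrow> 'a \<Rightarrow> real"
  assumes K: "simplicial_complex K"
    and f: "continuous_on S f" "f \<in> S \<rightarrow> realization_points K"
    and g: "continuous_on S g" "g \<in> S \<rightarrow> realization_points K"
    and sub: "\<And>s. s \<in> S \<Longrightarrow> {v. f s v \<noteq> 0} \<subseteq> {v. g s v \<noteq> 0}"
  shows "homotopic_with (\<lambda>_. True) (top_of_set S) (top_of_set (realization_points K)) f g"
proof -
  let ?H = "\<lambda>(t, s). (\<lambda>v. (1 - t) * f s v + t * g s v)"
  have "continuous_on ({0..1::real} \<times> S) (\<lambda>z. q (snd z) v)" if "continuous_on S q"
    for q :: "'b \<Rightarrow> 'a \<Rightarrow> real" and v
    by (rule continuous_on_product_then_coordinatewise, rule continuous_on_compose2[OF that])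
       (auto intro: continuous_on_snd continuous_on_id)
  then have "continuous_on ({0..1} \<times> S) (\<lambda>z. (1 - fst z) * f (snd z) v + fst z * g (snd z) v)" for v
    using f(1) g(1) by (intro continuous_intros)
  then have "continuous_on ({0..1} \<times> S) ?H"
    unfolding case_prod_beta by (rule continuous_on_coordinatewise_then_product)
  moreover have "?H z \<in> realization_points K" if "z \<in> {0..1} \<times> S" for z
  proof -
    from that obtain t s where z: "z = (t, s)" "0 \<le> t" "t \<le> 1" "s \<in> S" by auto
    then have "f s \<in> realization_points K" "g s \<in> realization_points K" using f g by auto
    then show ?thesis
      using convex_combination_in_realization[OF K realization_points_support[of "g s"]] sub z by auto
  qed
  ultimately show ?thesis
    unfolding homotopic_with_def
    by (intro exI[of _ ?H]) auto
qed

definition barycentric :: "'a set \<Rightarrow> ('a \<Rightarrow> real) \<Rightarrow> 'a \<Rightarrow> real" where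
  "barycentric V w v = w v / sum w V"

context
  fixes V :: "'a set" and w :: "'a \<Rightarrow> real"
  assumes V: "finite V" and w: "\<And>v. 0 \<le> w v" "{v. w v \<noteq> 0} \<subseteq> V" "{v. w v \<noteq> 0} \<noteq> {}"
begin

lemma barycentric_total_pos: "0 < sum w V"
proof -
  obtain v where v: "v \<in> V" "w v \<noteq> 0" using w by auto
  then show ?thesis using V w(1) by (intro sum_pos2[of V v]) (auto simp: order_less_le)
qed

lemma support_barycentric: "{v. barycentric V w v \<noteq> 0} = {v. w v \<noteq> 0}"
  using barycentric_total_pos by (auto simp: barycentric_def)

lemma barycentric_in_realization:
  assumes "{v. w v \<noteq> 0} \<in> K"
  shows "barycentric V w \<in> realization_points K"
proof -
  have "sum (barycentric V w) V = 1"
    using barycentric_total_pos by (simp add: barycentric_def flip: sum_divide_distrib)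
  then show ?thesis
    using assms support_barycentric sum_support[OF V, of "barycentric V w"] w barycentric_total_pos
    by (auto simp: realization_points_def barycentric_def)
qed

end

lemma continuous_on_barycentric:
  assumes "\<And>v. continuous_on S (\<lambda>s. w s v)" "\<And>s. s \<in> S \<Longrightarrow> sum (w s) V \<noteq> 0"
  shows "continuous_on S (\<lambda>s. barycentric V (w s))"
  unfolding barycentric_def
  by (intro continuous_on_coordinatewise_then_product continuous_intros ballI assms)

section \<open>Truncation of small coordinates\<close>

definition truncation :: "'a set \<Rightarrow> real \<Rightarrow> ('a \<Rightarrow> real) \<Rightarrow> 'a \<Rightarrow> real" where
  "truncation V \<epsilon> x = barycentric V (\<lambda>v. max 0 (x v - \<epsilon>))"

context
  fixes V :: "'a set" and K :: "'a set set" and \<epsilon> :: real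
  assumes K: "simplicial_complex K" and V: "finite V" "K \<subseteq> Pow V"
    and \<epsilon>: "0 < \<epsilon>" "card V * \<epsilon> < 1"
begin

text \<open>The coordinates sum to 1, so they cannot all be at most a number below their mean.\<close>

lemma exists_large_coordinate:
  assumes "x \<in> realization_points K"
  shows "\<exists>v\<in>V. \<epsilon> < x v"
proof (rule ccontr)
  assume "\<not> ?thesis"
  then have "sum x V \<le> card V * \<epsilon>" by (intro sum_bounded_above) auto
  moreover have "sum x V = 1"
    using realization_points_sum[OF assms] realization_points_support[OF assms] V by auto
  ultimately show False using \<epsilon> by simp
qed

lemma truncation_weights:
  assumes "x \<in> realization_points K"
  shows "{v. max 0 (x v - \<epsilon>) \<noteq> 0} = {v. \<epsilon> < x v}" "{v. \<epsilon> < x v} \<subseteq> {v. x v \<noteq> 0}"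
    "{v. \<epsilon> < x v} \<in> K" "{v. \<epsilon> < x v} \<subseteq> V" "{v. \<epsilon> < x v} \<noteq> {}"
proof -
  show *: "{v. \<epsilon> < x v} \<subseteq> {v. x v \<noteq> 0}" using \<epsilon> by auto
  show "{v. \<epsilon> < x v} \<in> K"
    using K * realization_points_support[OF assms] by (simp add: simplicial_complex_def)
  then show "{v. \<epsilon> < x v} \<subseteq> V" using V by auto
qed (use exists_large_coordinate[OF assms] in \<open>auto simp: max_def\<close>)

lemma support_truncation:
  assumes "x \<in> realization_points K"
  shows "{v. truncation V \<epsilon> x v \<noteq> 0} = {v. \<epsilon> < x v}"
  unfolding truncation_def
  using support_barycentric[OF V(1), of "\<lambda>v. max 0 (x v - \<epsilon>)"] truncation_weights[OF assms] by simp

lemma truncation_in_realization: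
  assumes "x \<in> realization_points K"
  shows "truncation V \<epsilon> x \<in> realization_points K"
  unfolding truncation_def
  by (rule barycentric_in_realization[OF V(1)]) (use truncation_weights[OF assms] in simp_all)

lemma continuous_on_truncation: "continuous_on (realization_points K) (truncation V \<epsilon>)"
  unfolding truncation_def
proof (rule continuous_on_barycentric)
  show "continuous_on (realization_points K) (\<lambda>x. max 0 (x v - \<epsilon>))" for v
    by (intro continuous_intros continuous_on_product_then_coordinatewise[OF continuous_on_id])
  show "(\<Sum>v\<in>V. max 0 (x v - \<epsilon>)) \<noteq> 0" if "x \<in> realization_points K" for x
    using barycentric_total_pos[OF V(1), of "\<lambda>v. max 0 (x v - \<epsilon>)"] truncation_weights[OF that]
    by simp
qed

lemma homotopic_truncation_id:
  "homotopic_with (\<lambda>_. True) (geometric_realization K) (geometric_realization K)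
     (truncation V \<epsilon>) id"
proof -
  have "{v. truncation V \<epsilon> x v \<noteq> 0} \<subseteq> {v. id x v \<noteq> 0}" if "x \<in> realization_points K" for x
    unfolding support_truncation[OF that] using truncation_weights(2)[OF that] by simp
  then show ?thesis
    unfolding geometric_realization_eq
    using homotopic_into_realization[OF K continuous_on_truncation _ continuous_on_id]
    by (auto simp: truncation_in_realization id_def)
qed

end

section \<open>From points of the realization to directions\<close>

text \<open>The weight of \<open>S\<close> is nonzero, and then positive, exactly if \<open>S\<close> lies between the large
  coordinates and the support of \<open>x\<close>. These products play the role
  of a partition of unity; they need no normalization, since only the ray spanned by the
  weighted sum matters.\<close>

definition between_weight :: "'a set \<Rightarrow> real \<Rightarrow> ('a \<Rightarrow> real) \<Rightarrow> 'a set \<Rightarrow> real" where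
  "between_weight V \<epsilon> x S = (\<Prod>v\<in>S. x v) * (\<Prod>v\<in>V - S. max 0 (\<epsilon> - x v))"

definition direction ::
    "'a set \<Rightarrow> ('a set \<Rightarrow> 'b::real_vector) \<Rightarrow> real \<Rightarrow> ('a \<Rightarrow> real) \<Rightarrow> 'b" where
  "direction V c \<epsilon> x = (\<Sum>S\<in>Pow V. between_weight V \<epsilon> x S *\<^sub>R c S)"

lemma between_weight_nonneg:
  assumes "\<And>v. 0 \<le> x v"
  shows "0 \<le> between_weight V \<epsilon> x S"
  unfolding between_weight_def by (intro mult_nonneg_nonneg prod_nonneg) (auto simp: assms)

lemma between_weight_nonzero_iff:
  assumes "finite V" "S \<subseteq> V" "\<And>v. 0 \<le> x v"
  shows "between_weight V \<epsilon> x S \<noteq> 0 \<longleftrightarrow> S \<subseteq> {v. x v \<noteq> 0} \<and> {v\<in>V. \<epsilon> \<le> x v} \<subseteq> S"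
proof -
  have "finite S" using assms finite_subset by auto
  have "(\<Prod>v\<in>S. x v) \<noteq> 0 \<longleftrightarrow> S \<subseteq> {v. x v \<noteq> 0}"
    using \<open>finite S\<close> by auto
  moreover have "max 0 (\<epsilon> - x v) = 0 \<longleftrightarrow> \<epsilon> \<le> x v" for v
    by auto
  then have "(\<Prod>v\<in>V - S. max 0 (\<epsilon> - x v)) \<noteq> 0 \<longleftrightarrow> {v\<in>V. \<epsilon> \<le> x v} \<subseteq> S"
    using assms(1) by auto
  ultimately show ?thesis by (simp add: between_weight_def)
qed

lemma continuous_on_direction:
  fixes c :: "'a set \<Rightarrow> 'b::real_normed_vector"
  shows "continuous_on A (direction V c \<epsilon>)"
  unfolding direction_def between_weight_def
  by (intro continuous_intros continuous_on_product_then_coordinatewise[OF continuous_on_id])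

text \<open>Every \<open>c S\<close> that enters the average with nonzero weight is positive on \<open>p w\<close>, because \<open>w\<close>
  belongs to all such \<open>S\<close>; and the support of \<open>x\<close> itself is one of them.\<close>

lemma inner_direction_pos:
  fixes c :: "'a set \<Rightarrow> 'b::real_inner" and p :: "'a \<Rightarrow> 'b"
  assumes K: "simplicial_complex K" and V: "finite V" "K \<subseteq> Pow V" and "0 < \<epsilon>"
    and c: "\<And>S v. S \<in> K \<Longrightarrow> v \<in> S \<Longrightarrow> 0 < c S \<bullet> p v"
    and x: "x \<in> realization_points K" and w: "w \<in> V" "\<epsilon> \<le> x w"
  shows "0 < direction V c \<epsilon> x \<bullet> p w"
proof -
  let ?S = "{v. x v \<noteq> 0}" and ?\<phi> = "between_weight V \<epsilon> x"
  note nonneg = realization_points_nonneg[OF x]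
  have S: "?S \<in> K" "?S \<subseteq> V" using realization_points_support[OF x] V by auto
  have pos: "0 < c T \<bullet> p w" if "T \<subseteq> V" "?\<phi> T \<noteq> 0" for T
  proof -
    have "T \<subseteq> ?S" "w \<in> T" using that between_weight_nonzero_iff[OF V(1), of T x] nonneg w by auto
    moreover have "T \<in> K" using K S(1) \<open>T \<subseteq> ?S\<close> by (auto simp: simplicial_complex_def)
    ultimately show ?thesis using c by blast
  qed
  have nz: "?\<phi> ?S \<noteq> 0"
    using between_weight_nonzero_iff[OF V(1) S(2)] nonneg \<open>0 < \<epsilon>\<close> by auto
  have "0 < (\<Sum>T\<in>Pow V. ?\<phi> T * (c T \<bullet> p w))"
  proof (rule sum_pos2[where i = ?S])
    show "0 < ?\<phi> ?S * (c ?S \<bullet> p w)"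
      using pos[OF S(2) nz] nz between_weight_nonneg[of x V \<epsilon> ?S] nonneg by simp
    show "0 \<le> ?\<phi> T * (c T \<bullet> p w)" if "T \<in> Pow V" for T
      using pos[of T] that between_weight_nonneg[of x V \<epsilon> T] nonneg
      by (cases "?\<phi> T = 0") auto
  qed (use V S in auto)
  then show ?thesis by (simp add: direction_def inner_sum_left)
qed

section \<open>From directions to points of the realization\<close>

definition cap_point :: "'a::real_inner set \<Rightarrow> 'a \<Rightarrow> 'a \<Rightarrow> 'a \<Rightarrow> real" where
  "cap_point V r u = barycentric V (\<lambda>v. if v \<in> V then max 0 (u \<bullet> (v - r)) else 0)"

lemma nonbalanced_cap: "{v\<in>V. 0 < u \<bullet> (v - r)} \<in> nonbalanced_complex V r"
proof -
  have "convex hull {v\<in>V. 0 < u \<bullet> (v - r)} \<subseteq> {v. u \<bullet> r < u \<bullet> v}"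
    by (intro hull_minimal convex_halfspace_gt) (auto simp: inner_diff_right)
  then show ?thesis by (auto simp: nonbalanced_complex_def balanced_def)
qed

text \<open>A cap in direction \<open>u\<close> with no vertex would confine the convex hull to a half-space whose
  boundary passes through \<open>r\<close>.\<close>

lemma cap_nonempty:
  fixes r :: "'a::euclidean_space"
  assumes "r \<in> interior (convex hull V)" "u \<noteq> 0"
  shows "{v\<in>V. 0 < u \<bullet> (v - r)} \<noteq> {}"
proof
  assume "{v\<in>V. 0 < u \<bullet> (v - r)} = {}"
  then have "convex hull V \<subseteq> {v. u \<bullet> v \<le> u \<bullet> r}"
    by (intro hull_minimal convex_halfspace_le) (auto simp: inner_diff_right not_less)
  then have "interior (convex hull V) \<subseteq> {v. u \<bullet> v < u \<bullet> r}"
    using interior_mono interior_halfspace_le[OF assms(2)] by blast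
  then show False using assms(1) by auto
qed

context
  fixes V :: "'a::euclidean_space set" and r :: 'a
  assumes V: "finite V" and r: "r \<in> interior (convex hull V)"
begin

lemma cap_weights:
  assumes "u \<noteq> 0"
  defines "w \<equiv> \<lambda>v. if v \<in> V then max 0 (u \<bullet> (v - r)) else 0"
  shows "0 \<le> w v" "{v. w v \<noteq> 0} = {v\<in>V. 0 < u \<bullet> (v - r)}" "{v. w v \<noteq> 0} \<subseteq> V"
    "{v. w v \<noteq> 0} \<noteq> {}" "{v. w v \<noteq> 0} \<in> nonbalanced_complex V r"
proof -
  show *: "{v. w v \<noteq> 0} = {v\<in>V. 0 < u \<bullet> (v - r)}" by (auto simp: w_def max_def)
  show "{v. w v \<noteq> 0} \<noteq> {}" "{v. w v \<noteq> 0} \<in> nonbalanced_complex V r"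
    unfolding * by (rule cap_nonempty[OF r assms(1)], rule nonbalanced_cap)
qed (auto simp: w_def)

lemma support_cap_point:
  "u \<noteq> 0 \<Longrightarrow> {v. cap_point V r u v \<noteq> 0} = {v\<in>V. 0 < u \<bullet> (v - r)}"
  unfolding cap_point_def by (subst support_barycentric[OF V]) (use cap_weights in auto)

lemma cap_point_in_realization:
  "u \<noteq> 0 \<Longrightarrow> cap_point V r u \<in> realization_points (nonbalanced_complex V r)"
  unfolding cap_point_def by (intro barycentric_in_realization[OF V] cap_weights)

lemma continuous_on_cap_point:
  assumes "0 \<notin> A"
  shows "continuous_on A (cap_point V r)"
  unfolding cap_point_def
proof (rule continuous_on_barycentric)
  show "continuous_on A (\<lambda>u. if v \<in> V then max 0 (u \<bullet> (v - r)) else 0)" for v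
    by (cases "v \<in> V") (simp_all add: continuous_on_max continuous_on_inner)
  show "(\<Sum>v\<in>V. if v \<in> V then max 0 (u \<bullet> (v - r)) else 0) \<noteq> 0" if "u \<in> A" for u
  proof -
    have "u \<noteq> 0" using that assms by auto
    then show ?thesis using barycentric_total_pos[OF V cap_weights(1,3,4), of u] by simp
  qed
qed

end

section \<open>The homotopy equivalence\<close>

lemma nonbalanced_separation:
  fixes V :: "'a::euclidean_space set"
  assumes "finite V" "S \<in> nonbalanced_complex V r"
  shows "\<exists>c. \<forall>v\<in>S. 0 < c \<bullet> (v - r)"
proof -
  have "finite S" "r \<notin> convex hull S"
    using assms finite_subset by (auto simp: nonbalanced_complex_def balanced_def)
  then obtain c b where "c \<bullet> r < b" "\<forall>v\<in>convex hull S. b < c \<bullet> v"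
    using separating_hyperplane_closed_point[of "convex hull S" r]
    by (auto simp: compact_imp_closed finite_imp_compact_convex_hull)
  then have "\<forall>v\<in>S. 0 < c \<bullet> (v - r)"
    by (force simp: inner_diff_right intro: hull_inc)
  then show ?thesis ..
qed

text \<open>Radial projection turns a homotopy in the punctured space into one in the sphere.\<close>

lemma homotopic_into_sphere:
  fixes f g :: "'b::topological_space \<Rightarrow> 'a::real_normed_vector"
  assumes "continuous_on S f" "continuous_on S g"
    and "\<And>s. s \<in> S \<Longrightarrow> 0 \<notin> closed_segment (f s) (g s)"
  shows "homotopic_with (\<lambda>_. True) (top_of_set S) (top_of_set (sphere 0 1))
           (\<lambda>s. sgn (f s)) (\<lambda>s. sgn (g s))"
proof -
  have "homotopic_with (\<lambda>_. True) (top_of_set S) (top_of_set (- {0})) f g"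
    using assms by (intro homotopic_with_linear) auto
  moreover have "continuous_on (- {0}) (sgn :: 'a \<Rightarrow> 'a)"
    by (intro continuous_intros) auto
  moreover have "sgn \<in> - {0 :: 'a} \<rightarrow> sphere 0 1"
    by (auto simp: norm_sgn)
  ultimately have "homotopic_with (\<lambda>_. True) (top_of_set S) (top_of_set (sphere 0 1)) (sgn \<circ> f) (sgn \<circ> g)"
    by (rule homotopic_with_compose_continuous_left)
  then show ?thesis by (simp add: o_def)
qed

theorem theorem1:
  fixes V :: "(real ^ 'd) set" and r :: "real ^ 'd"
  assumes "finite V"
    and "r \<in> interior (convex hull V)"
  shows "geometric_realization (nonbalanced_complex V r)
           homotopy_equivalent_space top_of_set (sphere (0 :: real ^ 'd) 1)"
proof -
  define K where "K = nonbalanced_complex V r"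
  have K: "simplicial_complex K" "K \<subseteq> Pow V"
    using simplicial_complex_nonbalanced_complex[OF assms(1)]
    by (auto simp: K_def nonbalanced_complex_def)
  have "\<forall>S\<in>K. \<exists>c. \<forall>v\<in>S. 0 < c \<bullet> (v - r)"
    using nonbalanced_separation[OF assms(1)] by (auto simp: K_def)
  from bchoice[OF this] obtain c where c: "\<And>S v. S \<in> K \<Longrightarrow> v \<in> S \<Longrightarrow> 0 < c S \<bullet> (v - r)"
    by blast
  define \<epsilon> :: real where "\<epsilon> = 1 / (card V + 1)"
  have \<epsilon>: "0 < \<epsilon>" "card V * \<epsilon> < 1" by (auto simp: \<epsilon>_def field_simps)
  define h where "h = direction V c \<epsilon>"
  let ?f = "\<lambda>x. sgn (h x)" and ?g = "cap_point V r" and ?S = "sphere (0 :: real ^ 'd) 1"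
  note large = exists_large_coordinate[OF K(1) assms(1) K(2) \<epsilon>]
  have h_pos: "0 < h x \<bullet> (v - r)" if "x \<in> realization_points K" "v \<in> V" "\<epsilon> \<le> x v" for x v
    unfolding h_def by (rule inner_direction_pos[OF K(1) assms(1) K(2) \<epsilon>(1) c that])
  have h_nz: "h x \<noteq> 0" if "x \<in> realization_points K" for x
    using large[OF that] h_pos[OF that] by force
  have h_cont: "continuous_on A h" for A
    unfolding h_def by (rule continuous_on_direction)
  have f: "continuous_on (realization_points K) ?f" "?f \<in> realization_points K \<rightarrow> ?S"
    using h_nz by (auto intro!: continuous_on_sgn h_cont simp: norm_sgn)
  have g: "continuous_on ?S ?g" "?g \<in> ?S \<rightarrow> realization_points K"
    by (auto intro!: continuous_on_cap_point cap_point_in_realization assms simp: K_def)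
  have "homotopic_with (\<lambda>_. True) (geometric_realization K) (geometric_realization K)
          (truncation V \<epsilon>) (?g \<circ> ?f)"
    unfolding geometric_realization_eq
  proof (rule homotopic_into_realization[OF K(1)])
    show "continuous_on (realization_points K) (truncation V \<epsilon>)"
      by (rule continuous_on_truncation[OF K(1) assms(1) K(2) \<epsilon>])
    show "truncation V \<epsilon> \<in> realization_points K \<rightarrow> realization_points K"
      using truncation_in_realization[OF K(1) assms(1) K(2) \<epsilon>] by auto
    show "continuous_on (realization_points K) (?g \<circ> ?f)"
      unfolding o_def using f by (intro continuous_on_compose2[OF g(1)]) auto
    show "?g \<circ> ?f \<in> realization_points K \<rightarrow> realization_points K"
      using f g by (auto simp: Pi_iff)
    show "{v. truncation V \<epsilon> x v \<noteq> 0} \<subseteq> {v. (?g \<circ> ?f) x v \<noteq> 0}"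
      if x: "x \<in> realization_points K" for x
    proof -
      have "?f x \<noteq> 0" using h_nz[OF x] by (simp add: sgn_zero_iff)
      moreover have "0 < ?f x \<bullet> (v - r)" if "v \<in> V" "\<epsilon> < x v" for v
        using h_pos[OF x that(1)] that(2) h_nz[OF x] by (simp add: sgn_div_norm)
      ultimately show ?thesis
        using truncation_weights(4)[OF K(1) assms(1) K(2) \<epsilon> x]
        by (auto simp: support_truncation[OF K(1) assms(1) K(2) \<epsilon> x] support_cap_point[OF assms])
    qed
  qed
  then have gf: "homotopic_with (\<lambda>_. True) (geometric_realization K) (geometric_realization K)
          (?g \<circ> ?f) id"
    using homotopic_truncation_id[OF K(1) assms(1) K(2) \<epsilon>] homotopic_with_symD homotopic_with_trans
    by blast
  have "homotopic_with (\<lambda>_. True) (top_of_set ?S) (top_of_set ?S)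
          (\<lambda>u. sgn (h (?g u))) (\<lambda>u. sgn u)"
  proof (rule homotopic_into_sphere)
    show "continuous_on ?S (\<lambda>u. h (?g u))"
      by (rule continuous_on_compose2[OF h_cont g(1) order_refl])
    show "0 \<notin> closed_segment (h (?g u)) u" if u: "u \<in> ?S" for u
    proof -
      have gu: "?g u \<in> realization_points K" "u \<noteq> 0" using g u by auto
      obtain v where v: "v \<in> V" "\<epsilon> < ?g u v" using large[OF gu(1)] by blast
      \<comment> \<open>Both endpoints are positive on this one vertex, hence so is the whole segment.\<close>
      have "0 < h (?g u) \<bullet> (v - r)" using h_pos[OF gu(1)] v by simp
      moreover have "0 < u \<bullet> (v - r)"
      proof -
        have "v \<in> {v. ?g u v \<noteq> 0}" using v \<epsilon>(1) by simp
        then show ?thesis unfolding support_cap_point[OF assms gu(2)] by simp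
      qed
      ultimately have "closed_segment (h (?g u)) u \<subseteq> {y. 0 < (v - r) \<bullet> y}"
        by (intro closed_segment_subset convex_halfspace_gt) (auto simp: inner_commute)
      then show ?thesis by auto
    qed
  qed (rule continuous_on_id)
  then have fg: "homotopic_with (\<lambda>_. True) (top_of_set ?S) (top_of_set ?S) (?f \<circ> ?g) id"
    by (rule homotopic_with_eq) (auto simp: sgn_div_norm)
  show ?thesis
    unfolding homotopy_equivalent_space_def K_def[symmetric]
    using f g gf fg
    by (intro exI[of _ ?f] exI[of _ ?g])
       (auto simp: geometric_realization_eq image_subset_iff_funcset)
qed

end
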